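(* The group of holomorphic isometries of the Kähler manifold $T\mathcal{N}$ is the affine symplectic group $\mathrm{ASp}(2,\mathbb{R})=\mathrm{SL}(2,\mathbb{R})\ltimes\mathbb{R}^2$. That is, under the identification $T\mathcal{N}\cong\mathbb{H}\times\mathbb{C}$ and viewing $\mathrm{ASp}(2,\mathbb{R})$ as a subgroup of $\mathrm{Diff}(\mathbb{H}\times\mathbb{C})\cong\mathrm{Diff}(T\mathcal{N})$ through its effective action, the set of diffeomorphisms $\varphi$ of $T\mathcal{N}$ with $\varphi^*g=g$ and $\varphi_*J=J\varphi_*$ is exactly $\mathrm{ASp}(2,\mathbb{R})$.
   Context: $\mathcal{N}$ is the manifold of Gaussian densities $p(x;\mu,\sigma)=\frac{1}{\sqrt{2\pi}\sigma}e^{-(x-\mu)^2/(2\sigma^2)}$ on $\mathbb{R}$, with global natural coordinates $\theta_1=\mu/\sigma^2\in\mathbb{R}$, $\theta_2=-1/(2\sigma^2)<0$. $T\mathcal{N}$ carries the Kähler structure $(g,J,\omega)$ obtained by Dombrowski's construction from the Fisher metric $h_F$ and the exponential connection. Explicitly, with $\dot\theta_i=d\theta_i$ viewed as functions on $T\mathcal{N}$, $(\theta_1,\theta_2,\dot\theta_1,\dot\theta_2)$ are global coordinates on $T\mathcal{N}$ in which (with $I$ the $2\times 2$ identity matrix) $$g=\begin{bmatrix} h_F(\theta) & 0 \\ 0 & h_F(\theta) \end{bmatrix},\quad J=\begin{bmatrix} 0 & -I \\ I & 0 \end{bmatrix},\quad h_F(\theta)=\frac{1}{2\theta_2^2}\begin{bmatrix}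 -\theta_2 & \theta_1 \\ \theta_1 & \frac{\theta_2-\theta_1^2}{\theta_2} \end{bmatrix},$$ and $z_k=\theta_k+i\dot\theta_k$ ($k=1,2$) are global holomorphic coordinates. With $\mathbb{H}=\{\tau\in\mathbb{C}\mid\mathrm{Im}(\tau)>0\}$, $T\mathcal{N}$ is identified with $\mathbb{H}\times\mathbb{C}$ via the biholomorphism $(z_1,z_2)\mapsto(\tau,z)=(-iz_2,iz_1)$. $\mathrm{ASp}(2,\mathbb{R})$ is $\mathrm{SL}(2,\mathbb{R})\times\mathbb{R}^2$ with multiplication $(M_1,X_1)\cdot(M_2,X_2)=(M_1M_2,X_1M_2+X_2)$ (the $X_i$ being row vectors). It acts effectively on $\mathbb{H}\times\mathbb{C}$ by $$\Big(\begin{bmatrix} a & b \\ c & d \end{bmatrix},(\lambda,\mu)\Big)\cdot(\tau,z)=\Big(\frac{a\tau+b}{c\tau+d},\frac{z+\lambda\tau+\mu}{c\tau+d}\Big).$$ *)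

theory Defs
  imports "HOL-Analysis.Analysis" "HOL-Algebra.Bij"
begin

text \<open>Higher differentiability on an open set, through directional derivatives; for maps
between finite-dimensional spaces this is the usual notion.\<close>

primrec Ck_on :: "nat \<Rightarrow> 'a::euclidean_space set \<Rightarrow> ('a \<Rightarrow> 'b::euclidean_space) \<Rightarrow> bool" where
  "Ck_on 0 S f \<longleftrightarrow> continuous_on S f"
| "Ck_on (Suc k) S f \<longleftrightarrow>
     (\<forall>x\<in>S. f differentiable (at x)) \<and>
     (\<forall>v. Ck_on k S (\<lambda>x. frechet_derivative f (at x) v))"

definition smooth_on :: "'a::euclidean_space set \<Rightarrow> ('a \<Rightarrow> 'b::euclidean_space) \<Rightarrow> bool" where
  "smooth_on S f \<longleftrightarrow> (\<forall>k. Ck_on k S f)"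

text \<open>Self-diffeomorphisms of an open set. As in \<^const>\<open>Bij\<close>, they are
\<^const>\<open>undefined\<close> off the set, so that equality of functions is equality on the set.\<close>

definition Diff :: "'a::euclidean_space set \<Rightarrow> ('a \<Rightarrow> 'a) set" where
  "Diff S = {\<phi> \<in> Bij S. smooth_on S \<phi> \<and> smooth_on S (inv_into S \<phi>)}"

text \<open>The tangent bundle of the Gaussian family in its global coordinates
\<open>(\<theta>, \<theta>')\<close>, where \<open>\<theta> = (\<mu> / \<sigma>\<^sup>2, - 1 / (2 \<sigma>\<^sup>2))\<close> and \<open>\<theta>'\<close> is the fibre
coordinate. Every tangent space of it is \<^typ>\<open>(real^2) \<times> (real^2)\<close>.\<close>

type_synonym tn = "(real^2) \<times> (real^2)"

definition TN :: "tn set" where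
  "TN = {p. fst p $ 2 < 0}"

definition h_F :: "real^2 \<Rightarrow> real^2^2" where
  "h_F \<theta> = (1 / (2 * (\<theta>$2)\<^sup>2)) *\<^sub>R
     vector [vector [- (\<theta>$2), \<theta>$1],
             vector [\<theta>$1, (\<theta>$2 - (\<theta>$1)\<^sup>2) / \<theta>$2]]"

definition g_TN :: "tn \<Rightarrow> tn \<Rightarrow> tn \<Rightarrow> real" where
  "g_TN p u v = fst u \<bullet> (h_F (fst p) *v fst v) + snd u \<bullet> (h_F (fst p) *v snd v)"

text \<open>The complex structure has constant coefficients, so it does not depend on the base point.\<close>

definition J_TN :: "tn \<Rightarrow> tn" where
  "J_TN u = (- snd u, fst u)"

definition hol_isometries :: "(tn \<Rightarrow> tn) set" where
  "hol_isometries = {\<phi> \<in> Diff TN.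
     (\<forall>p\<in>TN. \<forall>u v. g_TN (\<phi> p) (frechet_derivative \<phi> (at p) u) (frechet_derivative \<phi> (at p) v)
        = g_TN p u v) \<and>
     (\<forall>p\<in>TN. \<forall>u. frechet_derivative \<phi> (at p) (J_TN u) = J_TN (frechet_derivative \<phi> (at p) u))}"

definition hol_isometry_group :: "(tn \<Rightarrow> tn) monoid" where
  "hol_isometry_group = (BijGroup TN)\<lparr>carrier := hol_isometries\<rparr>"

definition ASp2 :: "((real^2^2) \<times> (real^2)) monoid" where
  "ASp2 = \<lparr>carrier = {M. det M = 1} \<times> UNIV,
     mult = (\<lambda>(M1, X1) (M2, X2). (M1 ** M2, X1 v* M2 + X2)),
     one = (mat 1, 0)\<rparr>"

definition HC :: "(complex \<times> complex) set" where
  "HC = {\<tau>. Im \<tau> > 0} \<times> UNIV"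

fun ASp2_act :: "(real^2^2) \<times> (real^2) \<Rightarrow> complex \<times> complex \<Rightarrow> complex \<times> complex" where
  "ASp2_act (M, X) (\<tau>, z) =
     ((of_real (M$1$1) * \<tau> + of_real (M$1$2)) / (of_real (M$2$1) * \<tau> + of_real (M$2$2)),
      (z + of_real (X$1) * \<tau> + of_real (X$2)) / (of_real (M$2$1) * \<tau> + of_real (M$2$2)))"

text \<open>The identification \<open>(z\<^sub>1, z\<^sub>2) \<mapsto> (\<tau>, z) = (- \<i> z\<^sub>2, \<i> z\<^sub>1)\<close> of \<^const>\<open>TN\<close> with
\<^const>\<open>HC\<close>, where \<open>z\<^sub>k = \<theta>\<^sub>k + \<i> \<theta>'\<^sub>k\<close>.\<close>

definition TN_to_HC :: "tn \<Rightarrow> complex \<times> complex" where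
  "TN_to_HC p = (let z1 = Complex (fst p $ 1) (snd p $ 1); z2 = Complex (fst p $ 2) (snd p $ 2)
     in (- \<i> * z2, \<i> * z1))"

lemma bij_betw_TN_to_HC: "bij_betw TN_to_HC TN HC"
  unfolding bij_betw_def
proof
  show "inj_on TN_to_HC TN"
    by (auto simp: inj_on_def TN_to_HC_def complex_eq_iff vec_eq_iff forall_2)
  have "(\<tau>, z) \<in> TN_to_HC ` TN" if "Im \<tau> > 0" for \<tau> z
    using that
    by (intro image_eqI[of _ _ "(vector [Im z, - Im \<tau>], vector [- Re z, Re \<tau>])"])
       (auto simp: TN_def TN_to_HC_def complex_eq_iff)
  then show "TN_to_HC ` TN = HC"
    by (auto simp: TN_def HC_def TN_to_HC_def)
qed

definition ASp2_on_TN :: "(real^2^2) \<times> (real^2) \<Rightarrow> tn \<Rightarrow> tn" where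
  "ASp2_on_TN A = (\<lambda>p\<in>TN. inv_into TN TN_to_HC (ASp2_act A (TN_to_HC p)))"

end

theory Submission
  imports Defs "HOL-Algebra.Coset" "HOL-Complex_Analysis.Conformal_Mappings"
begin

text \<open>In the coordinates \<open>(\<tau>, z)\<close>, with \<open>y = Im \<tau>\<close>, the metric is
\<open>(|d\<tau>|\<^sup>2 / y\<^sup>2 + |dz - (Im z / y) d\<tau>|\<^sup>2 / y) / 2\<close>, and its invariance under the action is a direct
computation. Conversely, let \<open>(A, B)\<close> be a holomorphic isometry. For fixed \<open>\<tau>\<close>, the function
\<open>A(\<tau>, \<cdot>)\<close> is entire with values in the upper half-plane, hence constant by Liouville. So the
differential preserves the direction \<open>\<partial>\<^sub>z\<close>, hence also its orthogonal complement, and comparing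
lengths there gives equality in the Schwarz--Pick lemma for \<open>A\<close>, so that \<open>A\<close> is a real Moebius
transformation. After composition with its inverse, \<open>A = \<tau>\<close>. Then \<open>|\<partial>\<^sub>z B| = 1\<close>, so
\<open>B = \<delta>(\<tau>) z + \<beta>(\<tau>)\<close> by Liouville, and the horizontal part of the metric gives
\<open>\<partial>\<^sub>\<tau> B = (Im B - \<delta> Im z) / y\<close>. This forces \<open>\<delta> = 1\<close> or \<open>\<delta> = -1\<close> and makes \<open>\<beta>\<close> affine with
real coefficients.\<close>

subsection \<open>Smooth maps\<close>

text \<open>Induction on the order, over all functions that agree with a member of \<open>F\<close>
  on \<open>S\<close>: \<open>frechet_derivative g (at x) v\<close> is known only for
  \<open>x\<close> in \<open>S\<close>, where it equals \<open>D v x\<close>, so agreement on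
  \<open>S\<close> is what passes to the next order.\<close>

lemma smooth_on_if_derivative_closed:
  assumes S: "open S"
    and step: "\<And>f. f \<in> F \<Longrightarrow>
      \<exists>D. (\<forall>v. D v \<in> F) \<and> (\<forall>x\<in>S. (f has_derivative (\<lambda>v. D v x)) (at x))"
    and f: "f \<in> F" and g: "\<And>x. x \<in> S \<Longrightarrow> g x = f x"
  shows "smooth_on S g"
proof -
  have "Ck_on k S g" if "f \<in> F" "\<And>x. x \<in> S \<Longrightarrow> g x = f x" for k f g
    using that
  proof (induction k arbitrary: f g)
    case 0
    obtain D where "\<forall>x\<in>S. (f has_derivative (\<lambda>v. D v x)) (at x)"
      using step[OF 0(1)] by blast
    then have "continuous_on S f"
      by (intro continuous_at_imp_continuous_on ballI) (blast intro: has_derivative_continuous)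
    then show ?case
      using 0(2) by (simp cong: continuous_on_cong)
  next
    case (Suc k)
    obtain D where D: "\<And>v. D v \<in> F"
        and f: "\<And>x. x \<in> S \<Longrightarrow> (f has_derivative (\<lambda>v. D v x)) (at x)"
      using step[OF Suc.prems(1)] by blast
    have g: "(g has_derivative (\<lambda>v. D v x)) (at x)" if "x \<in> S" for x
      using has_derivative_transform_within_open[OF f[OF that] S that] Suc.prems(2) by simp
    have "frechet_derivative g (at x) v = D v x" if "x \<in> S" for x v
      using frechet_derivative_at[OF g[OF that]] by metis
    then show ?case
      using g Suc.IH[OF D] by (auto simp: differentiable_def)
  qed
  then show ?thesis
    using f g by (auto simp: smooth_on_def)
qed

lemma smooth_on_imp_has_derivative:
  assumes "smooth_on S f" "x \<in> S"
  shows "(f has_derivative frechet_derivative f (at x)) (at x)"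
proof -
  have "Ck_on (Suc 0) S f"
    using assms(1) unfolding smooth_on_def by blast
  then show ?thesis
    using assms(2) by (simp add: frechet_derivative_works)
qed

subsection \<open>The metric on the half-plane model\<close>

text \<open>A linear inverse of \<open>TN_to_HC\<close> on the whole space, so that, unlike with
  \<open>inv_into\<close>, transport between the two models needs no side conditions.\<close>

definition HC_to_TN :: "complex \<times> complex \<Rightarrow> tn" where
  "HC_to_TN q = (vector [Im (snd q), - Im (fst q)], vector [- Re (snd q), Re (fst q)])"

lemma TN_to_HC_eq:
  "TN_to_HC p = (Complex (snd p $ 2) (- (fst p $ 2)), Complex (- (snd p $ 1)) (fst p $ 1))"
  by (simp add: TN_to_HC_def complex_eq_iff)

lemma HC_to_TN_inverse [simp]: "TN_to_HC (HC_to_TN q) = q"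
  by (simp add: TN_to_HC_eq HC_to_TN_def prod_eq_iff complex_eq_iff)

lemma TN_to_HC_inverse [simp]: "HC_to_TN (TN_to_HC p) = p"
  by (simp add: TN_to_HC_eq HC_to_TN_def prod_eq_iff vec_eq_iff forall_2)

lemma TN_to_HC_in_HC_iff [simp]: "TN_to_HC p \<in> HC \<longleftrightarrow> p \<in> TN"
  by (simp add: TN_to_HC_eq HC_def TN_def)

lemma HC_to_TN_in_TN_iff [simp]: "HC_to_TN q \<in> TN \<longleftrightarrow> q \<in> HC"
  by (metis HC_to_TN_inverse TN_to_HC_in_HC_iff)

lemma bounded_linear_TN_to_HC: "bounded_linear TN_to_HC"
  by (intro linear_conv_bounded_linear[THEN iffD1] linearI)
     (simp_all add: TN_to_HC_eq complex_eq_iff)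

lemma bounded_linear_HC_to_TN: "bounded_linear HC_to_TN"
  by (intro linear_conv_bounded_linear[THEN iffD1] linearI)
     (simp_all add: HC_to_TN_def vec_eq_iff forall_2)

lemma inv_into_TN_to_HC: "q \<in> HC \<Longrightarrow> inv_into TN TN_to_HC q = HC_to_TN q"
  by (metis HC_to_TN_in_TN_iff HC_to_TN_inverse TN_to_HC_inverse inv_into_f_eq inj_on_def)

lemma open_HC: "open HC"
  unfolding HC_def by (intro open_Times open_halfspace_Im_gt open_UNIV)

lemma open_TN: "open TN"
proof -
  have "p \<in> TN \<longleftrightarrow> p \<in> TN_to_HC -` HC" for p
    by simp
  then have "TN = TN_to_HC -` HC"
    by blast
  then show ?thesis
    by (metis open_vimage open_HC linear_continuous_on bounded_linear_TN_to_HC)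
qed

text \<open>The component along the fibre \<open>\<partial>\<^sub>z\<close> with respect to the splitting of the tangent space into
\<open>\<partial>\<^sub>z\<close> and its orthogonal complement, which is spanned by \<open>(1, Im z / Im \<tau>)\<close>.\<close>

definition horizontal_defect :: "complex \<times> complex \<Rightarrow> complex \<times> complex \<Rightarrow> complex" where
  "horizontal_defect q u = snd u - of_real (Im (snd q) / Im (fst q)) * fst u"

definition g_HC :: "complex \<times> complex \<Rightarrow> complex \<times> complex \<Rightarrow> complex \<times> complex \<Rightarrow> real" where
  "g_HC q u v = (Re (fst u * cnj (fst v)) / (Im (fst q))\<^sup>2
     + Re (horizontal_defect q u * cnj (horizontal_defect q v)) / Im (fst q)) / 2"

lemma g_HC_self:
  "g_HC q u u = ((cmod (fst u))\<^sup>2 / (Im (fst q))\<^sup>2 + (cmod (horizontal_defect q u))\<^sup>2 / Im (fst q)) / 2"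
  unfolding cmod_power2 g_HC_def by (simp add: power2_eq_square)

definition times_i :: "complex \<times> complex \<Rightarrow> complex \<times> complex" where
  "times_i u = (\<i> * fst u, \<i> * snd u)"

lemma TN_to_HC_J_TN: "TN_to_HC (J_TN u) = times_i (TN_to_HC u)"
  by (simp add: TN_to_HC_eq J_TN_def times_i_def complex_eq_iff)

text \<open>Completing the square: with y = Im \<tau> the base coordinates are (Im z, -y), and the
  form of \<open>h_F\<close> on a vector (s, t) is (t^2 / y^2 + (s + (Im z / y) t)^2 / y) / 2. The
  first component of a tangent vector supplies the imaginary parts in \<open>g_HC\<close>, the
  second the real parts.\<close>

lemma g_TN_eq_g_HC:
  assumes "p \<in> TN"
  shows "g_TN p u v = g_HC (TN_to_HC p) (TN_to_HC u) (TN_to_HC v)"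
proof -
  have "fst p $ 2 \<noteq> 0"
    using assms by (simp add: TN_def)
  then show ?thesis
    unfolding g_TN_def g_HC_def horizontal_defect_def h_F_def TN_to_HC_eq
    by (simp add: inner_vec_def sum_2 matrix_vector_mult_def field_simps power2_eq_square)
qed

text \<open>First-order conditions at the points of \<open>HC\<close>, with the derivative under an
  existential; this form is stable under composition and depends only on the values on
  \<open>HC\<close>.\<close>

definition hol_isometric :: "(complex \<times> complex \<Rightarrow> complex \<times> complex) \<Rightarrow> bool" where
  "hol_isometric \<Phi> \<longleftrightarrow> (\<forall>q\<in>HC. \<Phi> q \<in> HC \<and> (\<exists>D. (\<Phi> has_derivative D) (at q) \<and>
     (\<forall>u. D (times_i u) = times_i (D u)) \<and> (\<forall>u v. g_HC (\<Phi> q) (D u) (D v) = g_HC q u v)))"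

lemma hol_isometric_compose:
  assumes "hol_isometric \<Phi>" "hol_isometric \<Psi>"
  shows "hol_isometric (\<Phi> \<circ> \<Psi>)"
  unfolding hol_isometric_def
proof (intro ballI conjI)
  fix q assume q: "q \<in> HC"
  then obtain D where D: "\<Psi> q \<in> HC" "(\<Psi> has_derivative D) (at q)"
      "\<And>u. D (times_i u) = times_i (D u)" "\<And>u v. g_HC (\<Psi> q) (D u) (D v) = g_HC q u v"
    using assms(2) unfolding hol_isometric_def by blast
  then obtain E where E: "\<Phi> (\<Psi> q) \<in> HC" "(\<Phi> has_derivative E) (at (\<Psi> q))"
      "\<And>u. E (times_i u) = times_i (E u)"
      "\<And>u v. g_HC (\<Phi> (\<Psi> q)) (E u) (E v) = g_HC (\<Psi> q) u v"
    using assms(1) unfolding hol_isometric_def by blast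
  show "(\<Phi> \<circ> \<Psi>) q \<in> HC"
    using E by simp
  show "\<exists>D. ((\<Phi> \<circ> \<Psi>) has_derivative D) (at q) \<and> (\<forall>u. D (times_i u) = times_i (D u)) \<and>
      (\<forall>u v. g_HC ((\<Phi> \<circ> \<Psi>) q) (D u) (D v) = g_HC q u v)"
    using diff_chain_at[OF D(2) E(2)] D(3,4) E(3,4) by (intro exI[of _ "E \<circ> D"]) simp
qed

text \<open>The chain rule conjugates the derivative by the linear identifications, which exchange
  \<open>J_TN\<close> with \<open>times_i\<close> and \<open>g_TN\<close> with
  \<open>g_HC\<close>.\<close>

lemma hol_isometries_iff:
  assumes "\<phi> \<in> Diff TN"
  shows "\<phi> \<in> hol_isometries \<longleftrightarrow> hol_isometric (TN_to_HC \<circ> \<phi> \<circ> HC_to_TN)"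
proof -
  let ?\<Phi> = "TN_to_HC \<circ> \<phi> \<circ> HC_to_TN"
  have deriv: "(\<phi> has_derivative frechet_derivative \<phi> (at p)) (at p)" if "p \<in> TN" for p
    using assms that smooth_on_imp_has_derivative[of TN \<phi> p] by (simp add: Diff_def)
  have maps: "\<phi> p \<in> TN" if "p \<in> TN" for p
    using assms that Bij_imp_funcset[of \<phi> TN] by (simp add: Diff_def Pi_iff)
  have local: "(?\<Phi> q \<in> HC \<and> (\<exists>D. (?\<Phi> has_derivative D) (at q) \<and>
      (\<forall>u. D (times_i u) = times_i (D u)) \<and> (\<forall>u v. g_HC (?\<Phi> q) (D u) (D v) = g_HC q u v))) \<longleftrightarrow>
      (\<forall>u v. g_TN (\<phi> p) (frechet_derivative \<phi> (at p) u) (frechet_derivative \<phi> (at p) v)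
        = g_TN p u v) \<and>
      (\<forall>u. frechet_derivative \<phi> (at p) (J_TN u) = J_TN (frechet_derivative \<phi> (at p) u))"
    if p: "p \<in> TN" and q: "q = TN_to_HC p" for p q
  proof -
    let ?E = "frechet_derivative \<phi> (at p)"
    let ?D = "TN_to_HC \<circ> ?E \<circ> HC_to_TN"
    have D: "(?\<Phi> has_derivative ?D) (at q)"
      using deriv[OF p] unfolding q
      by (intro diff_chain_at bounded_linear_imp_has_derivative bounded_linear_TN_to_HC
          bounded_linear_HC_to_TN) simp_all
    \<comment> \<open>Derivatives are unique, so the existential in \<open>hol_isometric\<close> can
      only refer to \<open>?D\<close>.\<close>
    have "(\<exists>D. (?\<Phi> has_derivative D) (at q) \<and> P D) \<longleftrightarrow> P ?D" for P
      using D has_derivative_unique[OF D] by metis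
    moreover have "(\<forall>u. ?D (times_i u) = times_i (?D u)) \<longleftrightarrow> (\<forall>u. ?E (J_TN u) = J_TN (?E u))"
      by (metis comp_apply HC_to_TN_inverse TN_to_HC_inverse TN_to_HC_J_TN)
    moreover have "(\<forall>u v. g_HC (?\<Phi> q) (?D u) (?D v) = g_HC q u v) \<longleftrightarrow>
        (\<forall>u v. g_TN (\<phi> p) (?E u) (?E v) = g_TN p u v)"
      unfolding q g_TN_eq_g_HC[OF p] g_TN_eq_g_HC[OF maps[OF p]]
      by (metis comp_apply HC_to_TN_inverse TN_to_HC_inverse)
    ultimately show ?thesis
      using maps[OF p] q by (simp only: comp_apply TN_to_HC_inverse TN_to_HC_in_HC_iff) blast
  qed
  have HC_eq: "HC = TN_to_HC ` TN"
    using bij_betw_TN_to_HC by (simp add: bij_betw_def)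
  have "hol_isometric ?\<Phi> \<longleftrightarrow> (\<forall>p\<in>TN.
      (\<forall>u v. g_TN (\<phi> p) (frechet_derivative \<phi> (at p) u) (frechet_derivative \<phi> (at p) v)
        = g_TN p u v) \<and>
      (\<forall>u. frechet_derivative \<phi> (at p) (J_TN u) = J_TN (frechet_derivative \<phi> (at p) u)))"
    unfolding hol_isometric_def by (subst HC_eq, subst ball_simps) (rule ball_cong[OF refl], rule local, simp_all)
  then show ?thesis
    unfolding hol_isometries_def using assms by blast
qed

lemma hol_isometric_cong:
  assumes "hol_isometric \<Phi>" "\<And>q. q \<in> HC \<Longrightarrow> \<Psi> q = \<Phi> q"
  shows "hol_isometric \<Psi>"
  unfolding hol_isometric_def
proof
  fix q assume q: "q \<in> HC"
  have "(\<Psi> has_derivative D) (at q)" if "(\<Phi> has_derivative D) (at q)" for D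
    using has_derivative_transform_within_open[OF that open_HC q] assms(2) by metis
  then show "\<Psi> q \<in> HC \<and> (\<exists>D. (\<Psi> has_derivative D) (at q) \<and>
      (\<forall>u. D (times_i u) = times_i (D u)) \<and> (\<forall>u v. g_HC (\<Psi> q) (D u) (D v) = g_HC q u v))"
    using assms q unfolding hol_isometric_def by metis
qed

subsection \<open>Smoothness of the action\<close>

text \<open>This class contains the components of the action and is closed under differentiation in a
fixed direction, which is what makes the action smooth.\<close>

inductive_set rational_maps :: "real \<Rightarrow> real \<Rightarrow> (complex \<times> complex \<Rightarrow> complex) set"
  for c d where
  const: "(\<lambda>q. k) \<in> rational_maps c d"
| fst: "fst \<in> rational_maps c d"
| snd: "snd \<in> rational_maps c d"
| inverse: "(\<lambda>q. inverse (of_real c * fst q + of_real d)) \<in> rational_maps c d"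
| add: "r \<in> rational_maps c d \<Longrightarrow> s \<in> rational_maps c d \<Longrightarrow> (\<lambda>q. r q + s q) \<in> rational_maps c d"
| mult: "r \<in> rational_maps c d \<Longrightarrow> s \<in> rational_maps c d \<Longrightarrow> (\<lambda>q. r q * s q) \<in> rational_maps c d"

text \<open>The imaginary part is c Im \<tau>, which vanishes only for c = 0; the factor is then the
  nonzero number d.\<close>

lemma automorphy_factor_nonzero:
  assumes "Im \<tau> > 0" "c \<noteq> 0 \<or> d \<noteq> 0"
  shows "of_real c * \<tau> + of_real d \<noteq> (0::complex)"
  using assms by (auto simp: complex_eq_iff)

lemma rational_maps_has_derivative:
  assumes "r \<in> rational_maps c d" "c \<noteq> 0 \<or> d \<noteq> 0"
  shows "\<exists>D. (\<forall>v. D v \<in> rational_maps c d) \<and>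
    (\<forall>q\<in>HC. (r has_derivative (\<lambda>v. D v q)) (at q))"
  using assms(1)
proof induction
  case (const k)
  show ?case
    by (intro exI[of _ "\<lambda>v q. 0"]) (auto intro: rational_maps.const)
next
  case fst
  show ?case
    by (intro exI[of _ "\<lambda>v q. fst v"]) (auto intro: rational_maps.const has_derivative_fst)
next
  case snd
  show ?case
    by (intro exI[of _ "\<lambda>v q. snd v"]) (auto intro: rational_maps.const has_derivative_snd)
next
  case inverse
  let ?i = "\<lambda>q. inverse (of_real c * fst q + of_real d) :: complex"
  \<comment> \<open>The derivative of the reciprocal is a constant multiple of its own square, so no
    new generators arise.\<close>
  have "(?i has_derivative (\<lambda>v. (- of_real c * fst v) * (?i q * ?i q))) (at q)" if "q \<in> HC" for q
    using automorphy_factor_nonzero[of "fst q" c d] that assms(2)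
    by (auto simp: HC_def intro!: derivative_eq_intros)
  moreover have "(\<lambda>q. (- of_real c * fst v) * (?i q * ?i q)) \<in> rational_maps c d"
    for v :: "complex \<times> complex"
    by (intro rational_maps.intros)
  ultimately show ?case
    by (intro exI[of _ "\<lambda>v q. (- of_real c * fst v) * (?i q * ?i q)"]) blast
next
  case (add r s)
  obtain D where D: "\<And>v. D v \<in> rational_maps c d"
      "\<And>q. q \<in> HC \<Longrightarrow> (r has_derivative (\<lambda>v. D v q)) (at q)"
    using add.IH(1) by auto
  obtain E where E: "\<And>v. E v \<in> rational_maps c d"
      "\<And>q. q \<in> HC \<Longrightarrow> (s has_derivative (\<lambda>v. E v q)) (at q)"
    using add.IH(2) by auto
  show ?case
    by (intro exI[of _ "\<lambda>v q. D v q + E v q"] conjI allI ballI rational_maps.add has_derivative_add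
        add.hyps D E)
next
  case (mult r s)
  obtain D where D: "\<And>v. D v \<in> rational_maps c d"
      "\<And>q. q \<in> HC \<Longrightarrow> (r has_derivative (\<lambda>v. D v q)) (at q)"
    using mult.IH(1) by auto
  obtain E where E: "\<And>v. E v \<in> rational_maps c d"
      "\<And>q. q \<in> HC \<Longrightarrow> (s has_derivative (\<lambda>v. E v q)) (at q)"
    using mult.IH(2) by auto
  show ?case
    by (intro exI[of _ "\<lambda>v q. r q * E v q + D v q * s q"] conjI allI ballI rational_maps.add rational_maps.mult has_derivative_mult
        mult.hyps D E)
qed

text \<open>As the identifications are linear, differentiating in direction \<open>v\<close>
  differentiates both components in direction \<open>TN_to_HC v\<close>; hence pairs of rational
  maps form a class closed under directional derivatives.\<close>

lemma smooth_on_rational: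
  assumes "r \<in> rational_maps c d" "s \<in> rational_maps c d" "c \<noteq> 0 \<or> d \<noteq> 0"
    and g: "\<And>p. p \<in> TN \<Longrightarrow> g p = HC_to_TN (r (TN_to_HC p), s (TN_to_HC p))"
  shows "smooth_on TN g"
proof (rule smooth_on_if_derivative_closed[OF open_TN])
  let ?f = "\<lambda>r s p. HC_to_TN (r (TN_to_HC p), s (TN_to_HC p))"
  let ?F = "{?f r s | r s. r \<in> rational_maps c d \<and> s \<in> rational_maps c d}"
  show "?f r s \<in> ?F"
    using assms(1,2) by blast
  fix f assume "f \<in> ?F"
  then obtain r s where f: "f = ?f r s" "r \<in> rational_maps c d" "s \<in> rational_maps c d"
    by blast
  obtain D where D: "\<And>v. D v \<in> rational_maps c d"
      "\<And>q. q \<in> HC \<Longrightarrow> (r has_derivative (\<lambda>v. D v q)) (at q)"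
    using rational_maps_has_derivative[OF f(2) assms(3)] by auto
  obtain E where E: "\<And>v. E v \<in> rational_maps c d"
      "\<And>q. q \<in> HC \<Longrightarrow> (s has_derivative (\<lambda>v. E v q)) (at q)"
    using rational_maps_has_derivative[OF f(3) assms(3)] by auto
  have "(f has_derivative (\<lambda>v. ?f (D (TN_to_HC v)) (E (TN_to_HC v)) p)) (at p)" if "p \<in> TN" for p
  proof -
    have T: "(TN_to_HC has_derivative TN_to_HC) (at p)"
      by (rule bounded_linear_imp_has_derivative[OF bounded_linear_TN_to_HC])
    have q: "TN_to_HC p \<in> HC"
      using that by simp
    show ?thesis
      unfolding f(1)
      using has_derivative_compose[OF T D(2)[OF q]] has_derivative_compose[OF T E(2)[OF q]]
      by (intro bounded_linear.has_derivative[OF bounded_linear_HC_to_TN] has_derivative_Pair)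
  qed
  moreover have "?f (D (TN_to_HC v)) (E (TN_to_HC v)) \<in> ?F" for v
    using D(1) E(1) by blast
  ultimately show "\<exists>D. (\<forall>v. D v \<in> ?F) \<and> (\<forall>p\<in>TN. (f has_derivative (\<lambda>v. D v p)) (at p))"
    by (intro exI[of _ "\<lambda>v. ?f (D (TN_to_HC v)) (E (TN_to_HC v))"] conjI allI ballI) 
qed (use g in auto)

subsection \<open>Schwarz--Pick with equality\<close>

definition linfrac :: "real \<Rightarrow> real \<Rightarrow> real \<Rightarrow> real \<Rightarrow> complex \<Rightarrow> complex" where
  "linfrac a b c d \<tau> = (of_real a * \<tau> + of_real b) / (of_real c * \<tau> + of_real d)"

text \<open>A point of the upper half-plane is nearer to \<open>p\<close> than to its mirror image
  \<open>cnj p\<close>: the squared distances differ by 4 Im \<tau> Im p.\<close>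

lemma cayley_norm_less_1:
  assumes "Im \<tau> > 0" "Im p > 0"
  shows "cmod ((\<tau> - p) / (\<tau> - cnj p)) < 1"
proof -
  have "(cmod (\<tau> - cnj p))\<^sup>2 - (cmod (\<tau> - p))\<^sup>2 = 4 * Im \<tau> * Im p"
    unfolding cmod_power2 by (simp add: power2_eq_square algebra_simps)
  then have "(cmod (\<tau> - p))\<^sup>2 < (cmod (\<tau> - cnj p))\<^sup>2"
    using assms by (smt (verit) mult_pos_pos)
  then have "cmod (\<tau> - p) < cmod (\<tau> - cnj p)"
    by (rule power2_less_imp_less) simp
  then show ?thesis
    by (smt (verit) divide_less_eq_1_pos norm_divide norm_ge_zero)
qed

text \<open>The imaginary part is (1 - |w|^2) / |1 - w|^2.\<close>

lemma Im_cayley_inverse_pos: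
  assumes "cmod w < 1"
  shows "Im (\<i> * (1 + w) / (1 - w)) > 0"
proof -
  have "w \<noteq> 1"
    using assms by auto
  then have "(Re (1 - w))\<^sup>2 + (Im (1 - w))\<^sup>2 > 0"
    by (simp add: sum_power2_gt_zero_iff complex_eq_iff)
  moreover have "Im (\<i> * (1 + w)) * Re (1 - w) - Re (\<i> * (1 + w)) * Im (1 - w) = 1 - (cmod w)\<^sup>2"
    unfolding cmod_power2 by (simp add: power2_eq_square algebra_simps)
  moreover have "(cmod w)\<^sup>2 < 1"
    using assms by (simp add: abs_square_less_1)
  ultimately show ?thesis
    by (simp only: Im_divide zero_less_divide_iff) simp
qed

text \<open>Writing \<open>\<alpha> = cnj \<eta> / \<eta>\<close> and clearing denominators gives both sides of the equation for \<open>w\<close>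
the form \<open>k (\<tau> + \<i>) - cnj k (\<tau> - \<i>)\<close>, which is \<open>2 \<i>\<close> times a polynomial with real coefficients.\<close>

lemma moebius_if_cayley_eq_rotation:
  assumes p: "Im p > 0" and \<alpha>: "cmod \<alpha> = 1"
  shows "\<exists>a b c d. a * d - b * c = 1 \<and> (\<forall>\<tau> w. Im \<tau> > 0 \<longrightarrow> Im w > 0 \<longrightarrow>
    (w - p) / (w - cnj p) = \<alpha> * ((\<tau> - \<i>) / (\<tau> + \<i>)) \<longrightarrow> w = linfrac a b c d \<tau>)"
proof -
  \<comment> \<open>A unit square root of \<open>cnj \<alpha>\<close>, which splits the rotation
    evenly between the two sides.\<close>
  define \<eta> where "\<eta> = cnj (csqrt \<alpha>)"
  have \<eta>: "cmod \<eta> = 1"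
    using \<alpha> by (simp add: \<eta>_def)
  then have \<eta>_unit: "\<eta> * cnj \<eta> = 1"
    by (simp add: complex_norm_square[symmetric])
  have "\<alpha> = cnj \<eta> * cnj \<eta>"
    by (simp add: \<eta>_def flip: power2_eq_square)
  then have \<eta>_\<alpha>: "\<eta> * \<alpha> = cnj \<eta>"
    using \<eta>_unit by (metis mult.assoc mult_1)
  \<comment> \<open>The coefficients obtained from \<eta> and \<eta> p have determinant Im p;
    dividing all four by \<open>s\<close> makes it 1.\<close>
  define s where "s = sqrt (Im p)"
  have s: "s > 0" "s * s = Im p"
    using p by (simp_all add: s_def)
  let ?a = "Im (\<eta> * p) / s" and ?b = "Re (\<eta> * p) / s" and ?c = "Im \<eta> / s" and ?d = "Re \<eta> / s"
  have "Re \<eta> * Re \<eta> + Im \<eta> * Im \<eta> = 1"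
    using \<eta> by (simp add: cmod_def power2_eq_square)
  moreover have "Im (\<eta> * p) * Re \<eta> - Re (\<eta> * p) * Im \<eta> = Im p * (Re \<eta> * Re \<eta> + Im \<eta> * Im \<eta>)"
    by (simp add: algebra_simps)
  ultimately have "Im (\<eta> * p) * Re \<eta> - Re (\<eta> * p) * Im \<eta> = s * s"
    using s(2) by simp
  then have det: "?a * ?d - ?b * ?c = 1"
    using s(1) by (simp add: diff_divide_distrib[symmetric])
  have "w = linfrac ?a ?b ?c ?d \<tau>" if \<tau>: "Im \<tau> > 0" and w: "Im w > 0"
    and eq: "(w - p) / (w - cnj p) = \<alpha> * ((\<tau> - \<i>) / (\<tau> + \<i>))" for \<tau> w
  proof -
    have "w - cnj p \<noteq> 0" "\<tau> + \<i> \<noteq> 0"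
      using \<tau> w p by (auto simp: complex_eq_iff)
    then have "(w - p) * (\<tau> + \<i>) = \<alpha> * (\<tau> - \<i>) * (w - cnj p)"
      using eq by (simp add: field_simps)
    then have "\<eta> * (w - p) * (\<tau> + \<i>) = cnj \<eta> * (\<tau> - \<i>) * (w - cnj p)"
      using \<eta>_\<alpha> by (metis mult.assoc)
    then have "w * (\<eta> * (\<tau> + \<i>) - cnj \<eta> * (\<tau> - \<i>)) = \<eta> * p * (\<tau> + \<i>) - cnj (\<eta> * p) * (\<tau> - \<i>)"
      by (simp add: algebra_simps)
    moreover have "k * (\<tau> + \<i>) - cnj k * (\<tau> - \<i>) = 2 * \<i> * (of_real (Im k) * \<tau> + of_real (Re k))" for k
      by (simp add: complex_eq_iff algebra_simps)
    ultimately have "w * (of_real (Im \<eta>) * \<tau> + of_real (Re \<eta>)) =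
        of_real (Im (\<eta> * p)) * \<tau> + of_real (Re (\<eta> * p))"
      by (simp only: mult.left_commute[of w] mult_cancel_left) auto
    moreover have "Im \<eta> \<noteq> 0 \<or> Re \<eta> \<noteq> 0"
      using \<eta>_unit by (auto simp: complex_eq_iff)
    then have "of_real (Im \<eta>) * \<tau> + of_real (Re \<eta>) \<noteq> (0::complex)"
      by (rule automorphy_factor_nonzero[OF \<tau>])
    ultimately have "w = linfrac (Im (\<eta> * p)) (Re (\<eta> * p)) (Im \<eta>) (Re \<eta>) \<tau>"
      by (simp add: linfrac_def field_simps)
    also have "\<dots> = linfrac ?a ?b ?c ?d \<tau>"
      using s(1) by (simp add: linfrac_def flip: add_divide_distrib)
    finally show ?thesis .
  qed
  with det show ?thesis
    by blast
qed

text \<open>Cayley transforms carry \<open>\<i>\<close> on the source and \<open>p\<close> on the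
  target to 0. The resulting self-map \<open>f\<close> of the disc fixes 0 with derivative of
  modulus 1, so it is a rotation by the Schwarz lemma.\<close>

lemma schwarz_pick_equality:
  assumes hol: "A holomorphic_on {\<tau>. Im \<tau> > 0}"
    and maps: "\<And>\<tau>. Im \<tau> > 0 \<Longrightarrow> Im (A \<tau>) > 0"
    and eq: "cmod (deriv A \<i>) = Im (A \<i>)"
  shows "\<exists>a b c d. a * d - b * c = 1 \<and> (\<forall>\<tau>. Im \<tau> > 0 \<longrightarrow> A \<tau> = linfrac a b c d \<tau>)"
proof -
  define p where "p = A \<i>"
  have p: "Im p > 0"
    using maps[of \<i>] by (simp add: p_def)
  define \<kappa> where "\<kappa> w = \<i> * (1 + w) / (1 - w)" for w :: complex
  define f where "f w = (A (\<kappa> w) - p) / (A (\<kappa> w) - cnj p)" for w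
  have \<kappa>: "Im (\<kappa> w) > 0" if "cmod w < 1" for w
    unfolding \<kappa>_def using that by (rule Im_cayley_inverse_pos)
  have nz: "A \<tau> - cnj p \<noteq> 0" if "Im \<tau> > 0" for \<tau>
    using maps[OF that] p by (auto simp: complex_eq_iff)
  have "\<kappa> holomorphic_on ball 0 1"
    unfolding \<kappa>_def by (intro holomorphic_intros) auto
  then have "(A \<circ> \<kappa>) holomorphic_on ball 0 1"
    using hol by (rule holomorphic_on_compose_gen) (auto intro: \<kappa>)
  then have f: "f holomorphic_on ball 0 1"
    unfolding f_def comp_def using nz \<kappa> by (intro holomorphic_intros) auto
  have f0: "f 0 = 0"
    by (simp add: f_def \<kappa>_def p_def)
  have f_less: "cmod (f w) < 1" if "cmod w < 1" for w
    unfolding f_def using cayley_norm_less_1 maps \<kappa> that p by blast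
  have "(A has_field_derivative deriv A \<i>) (at \<i>)"
    using hol by (rule holomorphic_derivI) (auto simp: open_halfspace_Im_gt)
  moreover have "(\<kappa> has_field_derivative 2 * \<i>) (at 0)"
    unfolding \<kappa>_def by (auto intro!: derivative_eq_intros)
  ultimately have A\<kappa>: "((\<lambda>w. A (\<kappa> w)) has_field_derivative deriv A \<i> * (2 * \<i>)) (at 0)"
    using DERIV_chain2[of A "deriv A \<i>" \<kappa> 0 "2 * \<i>" UNIV] by (simp add: \<kappa>_def[of 0])
  \<comment> \<open>The target Cayley transform has derivative 1 / (p - cnj p) = 1 / (2 \<i> Im p)
    at \<open>p\<close>, which cancels the factor 2 \<i> from \<open>\<kappa>\<close>.\<close>
  have "(f has_field_derivative deriv A \<i> / Im p) (at 0)"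
    unfolding f_def using A\<kappa> nz[of \<i>] p
    by (auto intro!: derivative_eq_intros simp: \<kappa>_def p_def complex_eq_iff Re_divide Im_divide)
  then have "cmod (deriv f 0) = 1"
    using p eq by (simp add: DERIV_imp_deriv norm_divide p_def)
  then obtain \<alpha> where \<alpha>: "cmod \<alpha> = 1" and f_eq: "\<And>w. cmod w < 1 \<Longrightarrow> f w = \<alpha> * w"
    using Schwarz_Lemma(3)[OF f f0 f_less, of 0] by auto
  have "(A \<tau> - p) / (A \<tau> - cnj p) = \<alpha> * ((\<tau> - \<i>) / (\<tau> + \<i>))" if \<tau>: "Im \<tau> > 0" for \<tau>
  proof -
    have "\<tau> + \<i> \<noteq> 0"
      using \<tau> by (auto simp: complex_eq_iff)
    then have "1 + (\<tau> - \<i>) / (\<tau> + \<i>) = 2 * \<tau> / (\<tau> + \<i>)"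
        "1 - (\<tau> - \<i>) / (\<tau> + \<i>) = 2 * \<i> / (\<tau> + \<i>)"
      by (simp_all add: field_simps)
    then have "\<kappa> ((\<tau> - \<i>) / (\<tau> + \<i>)) = \<tau>"
      using \<open>\<tau> + \<i> \<noteq> 0\<close> by (simp add: \<kappa>_def)
    moreover have "cmod ((\<tau> - \<i>) / (\<tau> + \<i>)) < 1"
      using cayley_norm_less_1[OF \<tau>, of \<i>] by simp
    ultimately show ?thesis
      using f_eq by (metis f_def)
  qed
  then show ?thesis
    using moebius_if_cayley_eq_rotation[OF p \<alpha>] maps by metis
qed

subsection \<open>The action is isometric\<close>

lemma ASp2_act_eq:
  "ASp2_act A q = (linfrac (fst A$1$1) (fst A$1$2) (fst A$2$1) (fst A$2$2) (fst q),
     (snd q + of_real (snd A$1) * fst q + of_real (snd A$2)) /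
     (of_real (fst A$2$1) * fst q + of_real (fst A$2$2)))"
  by (cases A; cases q) (simp add: linfrac_def)

text \<open>The numerator times the conjugate denominator has imaginary part (a d - b c) Im
  \<tau>.\<close>

lemma Im_linfrac:
  assumes "a * d - b * c = 1"
  shows "Im (linfrac a b c d \<tau>) = Im \<tau> / (cmod (of_real c * \<tau> + of_real d))\<^sup>2"
proof -
  have "Im \<tau> = (a * d - b * c) * Im \<tau>"
    using assms by simp
  then show ?thesis
    unfolding linfrac_def by (subst Im_divide) (simp add: cmod_power2 algebra_simps)
qed

text \<open>With the automorphy factor \<open>j\<close>, the differential divides the base component
  by j^2 and the horizontal defect by j, while Im \<tau> is divided by |j|^2; these factors cancel
  in both summands of \<open>g_HC\<close>.\<close>

lemma hol_isometric_ASp2_act: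
  assumes "A \<in> carrier ASp2"
  shows "hol_isometric (ASp2_act A)"
proof -
  obtain a b c d l m where
    act: "ASp2_act A = (\<lambda>q. (linfrac a b c d (fst q),
      (snd q + of_real l * fst q + of_real m) / (of_real c * fst q + of_real d)))"
    and det: "a * d - b * c = 1"
    using assms ASp2_act_eq by (force simp: ASp2_def det_2)
  have "ASp2_act A q \<in> HC \<and> (\<exists>D. (ASp2_act A has_derivative D) (at q) \<and>
     (\<forall>u. D (times_i u) = times_i (D u)) \<and> (\<forall>u v. g_HC (ASp2_act A q) (D u) (D v) = g_HC q u v))"
    if "q \<in> HC" for q
  proof -
    define \<tau> z where "\<tau> = fst q" and "z = snd q"
    define j \<zeta> where "j = of_real c * \<tau> + of_real d" and "\<zeta> = z + of_real l * \<tau> + of_real m"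
    define D where "D u = (fst u / j\<^sup>2, (snd u + of_real l * fst u) / j - \<zeta> * of_real c * fst u / j\<^sup>2)"
      for u :: "complex \<times> complex"
    have y: "Im \<tau> > 0"
      using that by (auto simp: HC_def \<tau>_def)
    have "c \<noteq> 0 \<or> d \<noteq> 0"
      using det by auto
    then have j: "j \<noteq> 0"
      unfolding j_def by (rule automorphy_factor_nonzero[OF y])
    have Im_act: "Im (fst (ASp2_act A q)) = Im \<tau> / (cmod j)\<^sup>2"
      by (simp add: act Im_linfrac[OF det] j_def \<tau>_def)
    have det': "of_real a * of_real d - of_real b * of_real c = (1::complex)"
      using det by (simp flip: of_real_mult of_real_diff)
    have \<tau>': "((\<lambda>q. linfrac a b c d (fst q)) has_derivative (\<lambda>u. fst u / j\<^sup>2)) (at q)"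
    proof -
      have "(of_real a * fst u * j - (of_real a * \<tau> + of_real b) * (of_real c * fst u)) / (j * j)
          = fst u / j\<^sup>2" for u :: "complex \<times> complex"
      proof -
        have "of_real a * fst u * j - (of_real a * \<tau> + of_real b) * (of_real c * fst u)
            = (of_real a * of_real d - of_real b * of_real c) * fst u"
          by (simp add: j_def algebra_simps)
        then show ?thesis
          by (simp only: det' mult_1 power2_eq_square)
      qed
      moreover have "((\<lambda>q. linfrac a b c d (fst q)) has_derivative (\<lambda>u. (of_real a * fst u * j
          - (of_real a * \<tau> + of_real b) * (of_real c * fst u)) / (j * j))) (at q)"
        unfolding linfrac_def using j
        by (auto intro!: derivative_eq_intros simp: j_def \<tau>_def)
      ultimately show ?thesis
        by simp
    qed
    have z': "((\<lambda>q. (snd q + of_real l * fst q + of_real m) / (of_real c * fst q + of_real d))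
        has_derivative (\<lambda>u. (snd u + of_real l * fst u) / j - \<zeta> * of_real c * fst u / j\<^sup>2)) (at q)"
    proof -
      have "((snd u + of_real l * fst u) * j - \<zeta> * (of_real c * fst u)) / (j * j)
          = (snd u + of_real l * fst u) / j - \<zeta> * of_real c * fst u / j\<^sup>2" for u :: "complex \<times> complex"
        using j by (simp add: diff_divide_distrib power2_eq_square)
      moreover have "((\<lambda>q. (snd q + of_real l * fst q + of_real m) / (of_real c * fst q + of_real d))
          has_derivative (\<lambda>u. ((snd u + of_real l * fst u) * j - \<zeta> * (of_real c * fst u)) / (j * j))) (at q)"
        using j by (auto intro!: derivative_eq_intros simp: j_def \<tau>_def \<zeta>_def z_def)
      ultimately show ?thesis
        by simp
    qed
    have deriv: "(ASp2_act A has_derivative D) (at q)"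
      unfolding act D_def using \<tau>' z' by (rule has_derivative_Pair)
    have "horizontal_defect (ASp2_act A q) (D u) = horizontal_defect q u / j" for u
    proof -
      have "Im (snd (ASp2_act A q)) = Im (\<zeta> * cnj j) / (cmod j)\<^sup>2"
        by (simp add: act j_def \<zeta>_def \<tau>_def z_def Im_divide cmod_power2)
      then have slope: "Im (snd (ASp2_act A q)) / Im (fst (ASp2_act A q)) = Im (\<zeta> * cnj j) / Im \<tau>"
        using j y by (simp add: Im_act field_simps)
      \<comment> \<open>The imaginary parts on the right cancel. This expresses the slope at the
        image through the slope Im z / Im \<tau> at \<open>q\<close>, and the terms with l and c
        then cancel against those in \<open>D\<close>.\<close>
      have key: "of_real (Im (\<zeta> * cnj j)) = of_real (Im \<tau>) * (of_real l * j - of_real c * \<zeta>) + of_real (Im z) * j"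
        by (simp add: complex_eq_iff \<zeta>_def j_def algebra_simps)
      have quotient: "of_real (Im (\<zeta> * cnj j) / Im \<tau>) =
          of_real l * j - of_real c * \<zeta> + of_real (Im z / Im \<tau>) * j"
        unfolding of_real_divide key using y by (simp add: add_divide_distrib)
      have "(t + of_real l * s) / j - \<zeta> * of_real c * s / j\<^sup>2
          - (of_real l * j - of_real c * \<zeta> + r * j) * (s / j\<^sup>2) = (t - r * s) / j" for r s t
        using j by (simp add: field_simps power2_eq_square)
      then show ?thesis
        unfolding horizontal_defect_def slope quotient D_def fst_conv snd_conv
          \<tau>_def[symmetric] z_def[symmetric] .
    qed
    moreover have "Re (x / j * cnj (y / j)) = Re (x * cnj y) / (cmod j)\<^sup>2" for x y
    proof -
      have "x / j * cnj (y / j) = x * cnj y / of_real ((cmod j)\<^sup>2)"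
        unfolding complex_norm_square by simp
      then show ?thesis
        by (metis Re_divide_of_real)
    qed
    moreover have "Re (x / j\<^sup>2 * cnj (y / j\<^sup>2)) = Re (x * cnj y) / ((cmod j)\<^sup>2)\<^sup>2" for x y
    proof -
      have "x / j\<^sup>2 * cnj (y / j\<^sup>2) = x * cnj y / of_real (((cmod j)\<^sup>2)\<^sup>2)"
        unfolding of_real_power[of "(cmod j)\<^sup>2"] complex_norm_square
        by (simp add: power_mult_distrib)
      then show ?thesis
        by (metis Re_divide_of_real)
    qed
    ultimately have "g_HC (ASp2_act A q) (D u) (D v) = g_HC q u v" for u v
      using j unfolding g_HC_def Im_act by (simp add: D_def power_divide \<tau>_def)
    moreover have "D (times_i u) = times_i (D u)" for u
      by (simp add: D_def times_i_def prod_eq_iff algebra_simps)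
    moreover have "ASp2_act A q \<in> HC"
      using y j Im_act by (simp add: HC_def mem_Times_iff)
    ultimately show ?thesis
      using deriv by blast
  qed
  then show ?thesis
    unfolding hol_isometric_def by blast
qed

subsection \<open>Classification of the isometries\<close>

text \<open>The Cayley transform makes \<open>f\<close> bounded, so Liouville applies; injectivity
  of the transform returns the claim to \<open>f\<close>.\<close>

lemma holomorphic_upper_half_plane_constant:
  assumes "f holomorphic_on UNIV" "\<And>z. Im (f z) > 0"
  shows "f z = f w"
proof -
  let ?g = "\<lambda>z. (f z - \<i>) / (f z - cnj \<i>)"
  have nz: "f z - cnj \<i> \<noteq> 0" for z
    using assms(2)[of z] by (auto simp: complex_eq_iff)
  have "?g holomorphic_on UNIV"
    using nz by (intro holomorphic_intros assms(1)) auto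
  moreover have "cmod (?g z) \<le> 1" for z
    using cayley_norm_less_1[OF assms(2)[of z], of \<i>] by simp
  then have "bounded (range ?g)"
    unfolding bounded_iff by blast
  ultimately have "?g constant_on UNIV"
    by (rule Liouville_theorem)
  then have "?g z = ?g w"
    unfolding constant_on_def by (elim exE) simp
  then have "(f z - \<i>) * (f w + \<i>) = (f w - \<i>) * (f z + \<i>)"
    using nz[of z] nz[of w] by (simp add: frac_eq_eq)
  then show ?thesis
    by (simp add: algebra_simps)
qed

text \<open>Commuting with \<open>times_i\<close> makes the real derivative complex linear, hence a
  complex 2 by 2 matrix.\<close>

lemma hol_isometric_coeffs:
  assumes "hol_isometric \<Phi>" "q \<in> HC"
  obtains a b c d where
    "(\<Phi> has_derivative (\<lambda>u. (a * fst u + b * snd u, c * fst u + d * snd u))) (at q)"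
    "\<And>u v. g_HC (\<Phi> q) (a * fst u + b * snd u, c * fst u + d * snd u)
       (a * fst v + b * snd v, c * fst v + d * snd v) = g_HC q u v"
proof -
  obtain D where D: "(\<Phi> has_derivative D) (at q)" "\<And>u. D (times_i u) = times_i (D u)"
      "\<And>u v. g_HC (\<Phi> q) (D u) (D v) = g_HC q u v"
    using assms unfolding hol_isometric_def by blast
  interpret D: bounded_linear D
    using D(1) by (rule has_derivative_bounded_linear)
  have scale: "D (k * fst u, k * snd u) = (k * fst (D u), k * snd (D u))" for k u
  proof -
    have "(k * fst u, k * snd u) = Re k *\<^sub>R u + Im k *\<^sub>R times_i u"
      by (simp add: times_i_def prod_eq_iff complex_eq_iff)
    then have "D (k * fst u, k * snd u) = Re k *\<^sub>R D u + Im k *\<^sub>R times_i (D u)"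
      by (simp only: D.add D.scaleR D(2))
    then show ?thesis
      by (simp add: times_i_def prod_eq_iff complex_eq_iff)
  qed
  define a b c d where "a = fst (D (1, 0))" "b = fst (D (0, 1))" "c = snd (D (1, 0))" "d = snd (D (0, 1))"
  have "D u = (a * fst u + b * snd u, c * fst u + d * snd u)" for u
  proof -
    have "u = (fst u * fst (1, 0), fst u * snd (1, 0)) + (snd u * fst (0, 1), snd u * snd (0, 1))"
      by (simp add: prod_eq_iff)
    then have "D u = (fst u * a, fst u * c) + (snd u * b, snd u * d)"
      unfolding a_b_c_d_def by (metis D.add scale)
    then show ?thesis
      by (simp add: mult.commute)
  qed
  then have D_eq: "D = (\<lambda>u. (a * fst u + b * snd u, c * fst u + d * snd u))"
    by (rule ext)
  show thesis
    using D(1,3) unfolding D_eq by (rule that)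
qed

lemma hol_isometric_partial_derivatives:
  assumes "hol_isometric \<Phi>" "Im \<tau> > 0"
  obtains a b c d where
    "((\<lambda>\<tau>. fst (\<Phi> (\<tau>, z))) has_field_derivative a) (at \<tau>)"
    "((\<lambda>z. fst (\<Phi> (\<tau>, z))) has_field_derivative b) (at z)"
    "((\<lambda>\<tau>. snd (\<Phi> (\<tau>, z))) has_field_derivative c) (at \<tau>)"
    "((\<lambda>z. snd (\<Phi> (\<tau>, z))) has_field_derivative d) (at z)"
    "\<And>s t v w. g_HC (\<Phi> (\<tau>, z)) (a * s + b * t, c * s + d * t) (a * v + b * w, c * v + d * w)
       = g_HC (\<tau>, z) (s, t) (v, w)"
proof -
  have "(\<tau>, z) \<in> HC"
    using assms(2) by (simp add: HC_def)
  then obtain a b c d where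
    D: "(\<Phi> has_derivative (\<lambda>u. (a * fst u + b * snd u, c * fst u + d * snd u))) (at (\<tau>, z))"
    and g: "\<And>u v. g_HC (\<Phi> (\<tau>, z)) (a * fst u + b * snd u, c * fst u + d * snd u)
       (a * fst v + b * snd v, c * fst v + d * snd v) = g_HC (\<tau>, z) u v"
    using hol_isometric_coeffs[OF assms(1)] by blast
  have 1: "((\<lambda>\<tau>. (\<tau>, z)) has_derivative (\<lambda>s. (s, 0))) (at \<tau>)"
    by (intro has_derivative_Pair has_derivative_ident has_derivative_const)
  have 2: "((\<lambda>z. (\<tau>, z)) has_derivative (\<lambda>t. (0, t))) (at z)"
    by (intro has_derivative_Pair has_derivative_ident has_derivative_const)
  note D1 = has_derivative_compose[OF 1 D] and D2 = has_derivative_compose[OF 2 D]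
  show thesis
  proof
    show "((\<lambda>\<tau>. fst (\<Phi> (\<tau>, z))) has_field_derivative a) (at \<tau>)"
      using has_derivative_fst[OF D1] by (simp add: has_field_derivative_def)
    show "((\<lambda>z. fst (\<Phi> (\<tau>, z))) has_field_derivative b) (at z)"
      using has_derivative_fst[OF D2] by (simp add: has_field_derivative_def)
    show "((\<lambda>\<tau>. snd (\<Phi> (\<tau>, z))) has_field_derivative c) (at \<tau>)"
      using has_derivative_snd[OF D1] by (simp add: has_field_derivative_def)
    show "((\<lambda>z. snd (\<Phi> (\<tau>, z))) has_field_derivative d) (at z)"
      using has_derivative_snd[OF D2] by (simp add: has_field_derivative_def)
  qed (use g[of "(_, _)" "(_, _)"] in simp)
qed

lemma hol_isometric_maps:
  assumes "hol_isometric \<Phi>" "Im \<tau> > 0"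
  shows "Im (fst (\<Phi> (\<tau>, z))) > 0"
proof -
  have "\<Phi> (\<tau>, z) \<in> HC"
    using assms unfolding hol_isometric_def by (simp add: HC_def)
  then show ?thesis
    by (auto simp: HC_def)
qed

text \<open>Equality in Schwarz--Pick at a single point determines the map, so the metric is
  examined only at (\<i>, 0).\<close>

lemma hol_isometric_base_moebius:
  assumes \<Phi>: "hol_isometric \<Phi>"
  shows "\<exists>a b c d. a * d - b * c = 1 \<and>
    (\<forall>\<tau> z. Im \<tau> > 0 \<longrightarrow> fst (\<Phi> (\<tau>, z)) = linfrac a b c d \<tau>)"
proof -
  let ?A = "\<lambda>\<tau> z. fst (\<Phi> (\<tau>, z))"
  have maps: "Im (?A \<tau> z) > 0" if "Im \<tau> > 0" for \<tau> z
    using hol_isometric_maps[OF \<Phi> that] .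
  have vertical: "?A \<tau> z = ?A \<tau> 0" if "Im \<tau> > 0" for \<tau> z
  proof (rule holomorphic_upper_half_plane_constant[of "?A \<tau>"])
    show "?A \<tau> holomorphic_on UNIV"
      unfolding holomorphic_on_open[OF open_UNIV]
      using hol_isometric_partial_derivatives[OF \<Phi> that] by metis
  qed (use maps that in blast)
  have hol: "(\<lambda>\<tau>. ?A \<tau> 0) holomorphic_on {\<tau>. Im \<tau> > 0}"
    unfolding holomorphic_on_open[OF open_halfspace_Im_gt]
    using hol_isometric_partial_derivatives[OF \<Phi>] by (metis mem_Collect_eq)
  have "cmod (deriv (\<lambda>\<tau>. ?A \<tau> 0) \<i>) = Im (?A \<i> 0)"
  proof -
    obtain a b c d where
      a: "((\<lambda>\<tau>. ?A \<tau> 0) has_field_derivative a) (at \<i>)" and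
      b: "(?A \<i> has_field_derivative b) (at 0)" and
      g: "\<And>s t v w. g_HC (\<Phi> (\<i>, 0)) (a * s + b * t, c * s + d * t) (a * v + b * w, c * v + d * w)
         = g_HC (\<i>, 0) (s, t) (v, w)"
      by (rule hol_isometric_partial_derivatives[OF \<Phi>, of \<i> 0]) auto
    have "?A \<i> = (\<lambda>z. ?A \<i> 0)"
      using vertical[of \<i>] by auto
    then have "(?A \<i> has_field_derivative 0) (at 0)"
      by (metis DERIV_const)
    then have b0: "b = 0"
      using b DERIV_unique by blast
    \<comment> \<open>At (\<i>, 0) the vector (1, 0) is horizontal; \<open>?W\<close> is the
      vertical part of its image (a, c).\<close>
    let ?W = "horizontal_defect (\<Phi> (\<i>, 0)) (a, c)" and ?y = "Im (?A \<i> 0)"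
    have y: "?y > 0"
      using maps by simp
    have defect: "horizontal_defect q (0, t) = t" "horizontal_defect (\<i>, 0) u = snd u" for q t u
      by (simp_all add: horizontal_defect_def)
    have "d \<noteq> 0"
      using g[of 0 1 0 1] b0 by (auto simp: g_HC_def horizontal_defect_def)
    \<comment> \<open>Orthogonality of (1, 0) to (0, 1) and to (0, \<i>) kills the real and the
      imaginary part respectively.\<close>
    moreover have "?W * cnj d = 0"
      using g[of 1 0 0 1] g[of 1 0 0 \<i>] b0 y
      by (simp add: g_HC_def defect complex_eq_iff algebra_simps)
    ultimately have "?W = 0"
      by simp
    then have "?y\<^sup>2 = (cmod a)\<^sup>2"
      using g[of 1 0 1 0] y by (simp add: g_HC_self defect)
    then have "cmod a = ?y"
      using y by (simp add: power2_eq_iff_nonneg)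
    then show ?thesis
      using a by (simp add: DERIV_imp_deriv)
  qed
  then obtain a b c d where "a * d - b * c = 1" "\<And>\<tau>. Im \<tau> > 0 \<Longrightarrow> ?A \<tau> 0 = linfrac a b c d \<tau>"
    using schwarz_pick_equality[OF hol] maps by blast
  with vertical show ?thesis
    by metis
qed

lemma hol_isometric_over_identity:
  assumes \<Psi>: "hol_isometric \<Psi>" and fst: "\<And>q. q \<in> HC \<Longrightarrow> fst (\<Psi> q) = fst q"
  shows "\<exists>A\<in>carrier ASp2. \<forall>q\<in>HC. \<Psi> q = ASp2_act A q"
proof -
  define B where "B \<tau> z = snd (\<Psi> (\<tau>, z))" for \<tau> z
  let ?H = "{\<tau>. Im \<tau> > 0}"
  have H: "open ?H" "convex ?H"
    by (simp_all add: open_halfspace_Im_gt convex_halfspace_Im_gt)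
  have fst_\<Psi>: "fst (\<Psi> (\<tau>, z)) = \<tau>" if "Im \<tau> > 0" for \<tau> z
    using fst[of "(\<tau>, z)"] that by (simp add: HC_def)
  have partials: "\<exists>d. cmod d = 1 \<and> (B \<tau> has_field_derivative d) (at z) \<and>
      ((\<lambda>\<tau>. B \<tau> z) has_field_derivative
        (of_real (Im (B \<tau> z)) - d * of_real (Im z)) / of_real (Im \<tau>)) (at \<tau>)"
    if \<tau>: "Im \<tau> > 0" for \<tau> z
  proof -
    obtain a b c d where
      a: "((\<lambda>\<tau>. fst (\<Psi> (\<tau>, z))) has_field_derivative a) (at \<tau>)" and
      b: "((\<lambda>z. fst (\<Psi> (\<tau>, z))) has_field_derivative b) (at z)" and
      c: "((\<lambda>\<tau>. B \<tau> z) has_field_derivative c) (at \<tau>)" and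
      d: "(B \<tau> has_field_derivative d) (at z)" and
      g: "\<And>s t v w. g_HC (\<Psi> (\<tau>, z)) (a * s + b * t, c * s + d * t) (a * v + b * w, c * v + d * w)
         = g_HC (\<tau>, z) (s, t) (v, w)"
      by (rule hol_isometric_partial_derivatives[OF \<Psi> \<tau>, of z]) (auto simp: B_def[abs_def])
    have "((\<lambda>\<tau>. fst (\<Psi> (\<tau>, z))) has_field_derivative 1) (at \<tau>)"
      by (rule has_field_derivative_transform_within_open[OF DERIV_ident H(1)])
         (use \<tau> fst_\<Psi> in auto)
    then have a1: "a = 1"
      using a DERIV_unique by blast
    have "(\<lambda>z. fst (\<Psi> (\<tau>, z))) = (\<lambda>z. \<tau>)"
      using fst_\<Psi>[OF \<tau>] by (rule ext)
    then have b0: "b = 0"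
      using b DERIV_const[of \<tau>] DERIV_unique by metis
    have "(cmod d)\<^sup>2 = 1"
      using g[of 0 1 0 1] \<tau> fst_\<Psi>[OF \<tau>] b0
      by (simp add: g_HC_self horizontal_defect_def)
    then have d1: "cmod d = 1"
      by (metis norm_ge_zero one_power2 power2_eq_iff_nonneg zero_le_one)
    \<comment> \<open>(1, \<open>?s\<close>) is the horizontal lift of 1. Since a = 1 and b = 0, the
      base summand already accounts for its whole length, so its image has no defect.\<close>
    let ?s = "of_real (Im z / Im \<tau>)"
    have "c + d * ?s - of_real (Im (B \<tau> z) / Im \<tau>) = 0"
      using g[of 1 ?s 1 ?s] \<tau> fst_\<Psi>[OF \<tau>] b0 a1
      by (simp add: g_HC_self horizontal_defect_def B_def)
    then have "c = (of_real (Im (B \<tau> z)) - d * of_real (Im z)) / of_real (Im \<tau>)"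
      by (simp add: diff_divide_distrib algebra_simps)
    with c d d1 show ?thesis
      by blast
  qed
  define \<beta> \<delta> where "\<beta> \<tau> = B \<tau> 0" and "\<delta> \<tau> = B \<tau> 1 - B \<tau> 0" for \<tau>
  have affine: "B \<tau> z = \<delta> \<tau> * z + \<beta> \<tau>" and \<delta>_deriv: "(B \<tau> has_field_derivative \<delta> \<tau>) (at z)"
    and \<delta>1: "cmod (\<delta> \<tau>) = 1"
    if \<tau>: "Im \<tau> > 0" for \<tau> z
  proof -
    \<comment> \<open>The fibre derivative is entire of modulus 1, hence constant by
      Liouville.\<close>
    have d: "(B \<tau> has_field_derivative deriv (B \<tau>) z) (at z)" "cmod (deriv (B \<tau>) z) = 1" for z
      using partials[OF \<tau>, of z] DERIV_imp_deriv by blast+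
    then have "B \<tau> holomorphic_on UNIV"
      unfolding holomorphic_on_open[OF open_UNIV] by blast
    then have "deriv (B \<tau>) holomorphic_on UNIV"
      by (intro holomorphic_deriv open_UNIV)
    moreover have "bounded (range (deriv (B \<tau>)))"
      using d(2) by (auto simp: bounded_iff)
    ultimately have "deriv (B \<tau>) constant_on UNIV"
      by (rule Liouville_theorem)
    then obtain k where k: "\<And>z. deriv (B \<tau>) z = k"
      unfolding constant_on_def by auto
    have "((\<lambda>z. B \<tau> z - k * z) has_field_derivative 0) (at z)" for z
      using d(1)[of z] unfolding k by (auto intro!: derivative_eq_intros)
    then obtain m where m: "\<And>z. B \<tau> z - k * z = m"
      using has_field_derivative_zero_constant[of UNIV "\<lambda>z. B \<tau> z - k * z"] by auto
    have "\<delta> \<tau> = k" "\<beta> \<tau> = m"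
      using m[of 0] m[of 1] by (auto simp: \<delta>_def \<beta>_def algebra_simps)
    then show "B \<tau> z = \<delta> \<tau> * z + \<beta> \<tau>" "(B \<tau> has_field_derivative \<delta> \<tau>) (at z)" "cmod (\<delta> \<tau>) = 1"
      using m[of z] d[of z] k[of z] by (auto simp: algebra_simps)
  qed
  have horizontal: "((\<lambda>\<tau>. B \<tau> z) has_field_derivative
      (of_real (Im (\<delta> \<tau> * z + \<beta> \<tau>)) - \<delta> \<tau> * of_real (Im z)) / of_real (Im \<tau>)) (at \<tau>)"
    if "Im \<tau> > 0" for \<tau> z
    using partials[OF that, of z] affine[OF that, of z] \<delta>_deriv[OF that, of z] DERIV_unique by metis
  have \<beta>': "(\<beta> has_field_derivative of_real (Im (\<beta> \<tau>) / Im \<tau>)) (at \<tau>)" if "Im \<tau> > 0" for \<tau>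
    using horizontal[OF that, of 0] by (simp add: \<beta>_def[abs_def])
  \<comment> \<open>The difference of the horizontal equations at z = 1 and z = 0.\<close>
  have \<delta>': "(\<delta> has_field_derivative of_real (Im (\<delta> \<tau>) / Im \<tau>)) (at \<tau>)" if "Im \<tau> > 0" for \<tau>
    using DERIV_diff[OF horizontal[OF that, of 1] horizontal[OF that, of 0]]
    by (simp add: \<delta>_def[abs_def] flip: diff_divide_distrib)
  \<comment> \<open>The same difference at z = \<i> and z = 0 must be \<i> times the derivative of
    \<delta>; the two values are -\<i> Im \<delta> / Im \<tau> and \<i> Im \<delta> / Im
    \<tau>.\<close>
  have Im_\<delta>: "Im (\<delta> \<tau>) = 0" if \<tau>: "Im \<tau> > 0" for \<tau>
  proof -
    have "((\<lambda>\<tau>. B \<tau> \<i> - B \<tau> 0) has_field_derivative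
        (of_real (Re (\<delta> \<tau>)) - \<delta> \<tau>) / of_real (Im \<tau>)) (at \<tau>)"
      using DERIV_diff[OF horizontal[OF \<tau>, of \<i>] horizontal[OF \<tau>, of 0]]
      by (simp add: algebra_simps flip: diff_divide_distrib)
    moreover have "((\<lambda>\<tau>. B \<tau> \<i> - B \<tau> 0) has_field_derivative
        \<i> * of_real (Im (\<delta> \<tau>) / Im \<tau>)) (at \<tau>)"
      by (rule has_field_derivative_transform_within_open[OF DERIV_cmult[OF \<delta>'[OF \<tau>]] H(1)])
         (use \<tau> affine in auto)
    ultimately have "(of_real (Re (\<delta> \<tau>)) - \<delta> \<tau>) / of_real (Im \<tau>) = \<i> * of_real (Im (\<delta> \<tau>) / Im \<tau>)"
      by (rule DERIV_unique)
    then show ?thesis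
      using \<tau> by (simp add: complex_eq_iff field_simps)
  qed
  have "(\<delta> has_field_derivative 0) (at \<tau> within ?H)" if "\<tau> \<in> ?H" for \<tau>
    using \<delta>'[of \<tau>] Im_\<delta>[of \<tau>] that by (auto intro: has_field_derivative_at_within)
  then obtain k where k: "\<And>\<tau>. Im \<tau> > 0 \<Longrightarrow> \<delta> \<tau> = k"
    using has_field_derivative_zero_constant[OF H(2)] by blast
  have "Im k = 0" "cmod k = 1"
    using k[of \<i>] Im_\<delta>[of \<i>] \<delta>1[of \<i>] by auto
  then obtain \<epsilon> where \<epsilon>: "k = of_real \<epsilon>" "\<epsilon> * \<epsilon> = 1"
    by (metis complex_is_Real_iff Reals_cases norm_of_real abs_mult_self_eq mult_1)
  \<comment> \<open>The derivative of \<beta> is the real number Im \<beta> / Im \<tau>, so the two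
    terms of the quotient rule cancel. The constant value of this quotient is the slope
    \<open>l\<close> of \<beta>.\<close>
  have "((\<lambda>\<tau>. Im (\<beta> \<tau>) / Im \<tau>) has_derivative (\<lambda>h. 0)) (at \<tau> within ?H)" if "\<tau> \<in> ?H" for \<tau>
  proof -
    have \<beta>_deriv: "(\<beta> has_derivative (*) (of_real (Im (\<beta> \<tau>) / Im \<tau>))) (at \<tau> within ?H)"
      using \<beta>'[of \<tau>] that unfolding has_field_derivative_def
      by (simp only: mem_Collect_eq has_derivative_at_withinI)
    have "((\<lambda>\<tau>. Im (\<beta> \<tau>) / Im \<tau>) has_derivative
        (\<lambda>h. - Im (\<beta> \<tau>) * (inverse (Im \<tau>) * Im h * inverse (Im \<tau>)) +
          Im (of_real (Im (\<beta> \<tau>) / Im \<tau>) * h) / Im \<tau>)) (at \<tau> within ?H)"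
      using that by (intro has_derivative_divide has_derivative_Im has_derivative_ident \<beta>_deriv) auto
    moreover have "- Im (\<beta> \<tau>) * (inverse (Im \<tau>) * Im h * inverse (Im \<tau>)) +
          Im (of_real (Im (\<beta> \<tau>) / Im \<tau>) * h) / Im \<tau> = 0" for h
      using that by (simp add: field_simps)
    ultimately show ?thesis
      by simp
  qed
  then have "\<exists>l. \<forall>\<tau>\<in>?H. Im (\<beta> \<tau>) / Im \<tau> = l"
    by (rule has_derivative_zero_constant[OF H(2)])
  then obtain l where l: "\<And>\<tau>. Im \<tau> > 0 \<Longrightarrow> Im (\<beta> \<tau>) / Im \<tau> = l"
    by auto
  have "((\<lambda>\<tau>. \<beta> \<tau> - of_real l * \<tau>) has_field_derivative 0) (at \<tau> within ?H)" if "\<tau> \<in> ?H" for \<tau>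
  proof (rule has_field_derivative_at_within)
    have "((\<lambda>\<tau>. \<beta> \<tau> - of_real l * \<tau>) has_field_derivative
        of_real (Im (\<beta> \<tau>) / Im \<tau>) - of_real l * 1) (at \<tau>)"
      using that by (intro DERIV_diff DERIV_cmult DERIV_ident \<beta>') simp
    then show "((\<lambda>\<tau>. \<beta> \<tau> - of_real l * \<tau>) has_field_derivative 0) (at \<tau>)"
      using l[of \<tau>] that by (simp del: of_real_divide)
  qed
  then have "\<exists>m. \<forall>\<tau>\<in>?H. \<beta> \<tau> - of_real l * \<tau> = m"
    by (rule has_field_derivative_zero_constant[OF H(2)])
  then obtain m where m: "\<And>\<tau>. Im \<tau> > 0 \<Longrightarrow> \<beta> \<tau> - of_real l * \<tau> = m"
    by auto
  have "Im m = 0"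
    using m[of \<i>] l[of \<i>] by auto
  then have B_eq: "B \<tau> z = of_real \<epsilon> * z + of_real l * \<tau> + of_real (Re m)" if "Im \<tau> > 0" for \<tau> z
    using affine[OF that, of z] k[OF that] m[OF that] \<epsilon>(1) by (simp add: complex_eq_iff algebra_simps)
  \<comment> \<open>The action of this element divides by \<epsilon>, so the translation part
    carries a compensating factor \<epsilon>, and z / \<epsilon> = \<epsilon> z because \<epsilon>^2
    = 1.\<close>
  let ?A = "(vector [vector [\<epsilon>, 0], vector [0, \<epsilon>]], vector [\<epsilon> * l, \<epsilon> * Re m]) :: (real^2^2) \<times> (real^2)"
  have "\<Psi> q = ASp2_act ?A q" if q_HC: "q \<in> HC" for q
  proof -
    obtain \<tau> z where q: "q = (\<tau>, z)" and \<tau>: "Im \<tau> > 0"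
      using q_HC unfolding HC_def by blast
    have "\<epsilon> = 1 \<or> \<epsilon> = -1"
      using \<epsilon>(2) by (simp add: square_eq_1_iff)
    moreover have "\<Psi> q = (\<tau>, B \<tau> z)"
      using fst_\<Psi>[OF \<tau>] by (simp add: q B_def prod_eq_iff)
    ultimately show ?thesis
      using B_eq[OF \<tau>] by (auto simp: q)
  qed
  moreover have "?A \<in> carrier ASp2"
    using \<epsilon>(2) by (simp add: ASp2_def det_2)
  ultimately show ?thesis
    by blast
qed

subsection \<open>The group of isometries\<close>

text \<open>In homogeneous form, with numerators \<open>r\<close>, \<open>x\<close> and common
  denominator \<open>j\<close> for \<open>B\<close>, the product acts linearly on \<open>r\<close>,
  \<open>j\<close>, \<open>x\<close>; cancelling \<open>j\<close> gives the composition.\<close>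

lemma ASp2_act_mult:
  assumes "A \<in> carrier ASp2" "B \<in> carrier ASp2" "q \<in> HC"
  shows "ASp2_act (A \<otimes>\<^bsub>ASp2\<^esub> B) q = ASp2_act A (ASp2_act B q)"
proof -
  obtain M X where A: "A = (M, X)" by (cases A)
  obtain N Y where B: "B = (N, Y)" by (cases B)
  obtain \<tau> z where q: "q = (\<tau>, z)" by (cases q)
  have \<tau>: "Im \<tau> > 0"
    using assms(3) by (simp add: q HC_def)
  have "N$2$1 \<noteq> 0 \<or> N$2$2 \<noteq> 0"
    using assms(2) by (auto simp: B ASp2_def det_2)
  then have j: "of_real (N$2$1) * \<tau> + of_real (N$2$2) \<noteq> (0::complex)"
    by (rule automorphy_factor_nonzero[OF \<tau>])
  define j r x where "j = of_real (N$2$1) * \<tau> + of_real (N$2$2)"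
    and "r = of_real (N$1$1) * \<tau> + of_real (N$1$2)"
    and "x = z + of_real (Y$1) * \<tau> + of_real (Y$2)"
  have "ASp2_act (A \<otimes>\<^bsub>ASp2\<^esub> B) q =
      ((of_real (M$1$1) * r + of_real (M$1$2) * j) / (of_real (M$2$1) * r + of_real (M$2$2) * j),
       (x + of_real (X$1) * r + of_real (X$2) * j) / (of_real (M$2$1) * r + of_real (M$2$2) * j))"
    by (simp add: A B q ASp2_def j_def r_def x_def matrix_matrix_mult_def
        vector_matrix_mult_def sum_2 algebra_simps)
  also have "\<dots> = ASp2_act A (r / j, x / j)"
    using j by (simp add: A j_def[symmetric] divide_simps)
  also have "(r / j, x / j) = ASp2_act B q"
    by (simp add: B q j_def r_def x_def)
  finally show ?thesis .
qed

lemma ASp2_act_one: "ASp2_act \<one>\<^bsub>ASp2\<^esub> q = q"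
  by (cases q) (simp add: ASp2_def mat_def)

lemma ASp2_act_HC: "A \<in> carrier ASp2 \<Longrightarrow> q \<in> HC \<Longrightarrow> ASp2_act A q \<in> HC"
  using hol_isometric_ASp2_act unfolding hol_isometric_def by blast

lemma group_ASp2: "group ASp2"
proof (rule groupI)
  fix A assume A: "A \<in> carrier ASp2"
  obtain M X where M: "A = (M, X)" "det M = 1"
    using A by (cases A) (simp add: ASp2_def)
  then have "invertible M"
    by (simp add: invertible_det_nz)
  then obtain N where inv: "N ** M = mat 1"
    unfolding invertible_def by blast
  then have "det N = 1"
    using M(2) by (metis det_I det_mul mult.right_neutral)
  \<comment> \<open>The translation part -X N becomes -X after multiplication by M and cancels
    X.\<close>
  with inv show "\<exists>B\<in>carrier ASp2. B \<otimes>\<^bsub>ASp2\<^esub> A = \<one>\<^bsub>ASp2\<^esub>"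
    by (intro bexI[of _ "(N, (- X) v* N)"]) (simp_all add: M ASp2_def vector_matrix_mul_assoc)
qed (auto simp: ASp2_def det_mul det_I matrix_mul_assoc vector_matrix_mul_assoc
    vector_matrix_left_distrib add.assoc)

text \<open>A group element with the same base map as \<Phi> is divided out, which leaves an
  isometry covering the identity of the half-plane.\<close>

lemma hol_isometric_imp_ASp2_act:
  assumes \<Phi>: "hol_isometric \<Phi>"
  shows "\<exists>A\<in>carrier ASp2. \<forall>q\<in>HC. \<Phi> q = ASp2_act A q"
proof -
  interpret group ASp2
    by (rule group_ASp2)
  obtain a b c d where det: "a * d - b * c = 1"
      and fst: "\<And>\<tau> z. Im \<tau> > 0 \<Longrightarrow> fst (\<Phi> (\<tau>, z)) = linfrac a b c d \<tau>"
    using hol_isometric_base_moebius[OF \<Phi>] by blast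
  \<comment> \<open>The base component of the action depends only on the matrix, so translation part
    0 is a valid choice.\<close>
  define A :: "(real^2^2) \<times> (real^2)" where "A = (vector [vector [a, b], vector [c, d]], 0)"
  have A: "A \<in> carrier ASp2"
    using det by (simp add: A_def ASp2_def det_2)
  let ?\<Psi> = "ASp2_act (inv\<^bsub>ASp2\<^esub> A) \<circ> \<Phi>"
  have \<Phi>_HC: "\<Phi> q \<in> HC" if "q \<in> HC" for q
    using \<Phi> that unfolding hol_isometric_def by blast
  have fst_\<Psi>: "fst (?\<Psi> q) = fst q" if q: "q \<in> HC" for q
  proof -
    have "fst (\<Phi> q) = fst (ASp2_act A q)"
      using fst[of "fst q" "snd q"] q by (auto simp: HC_def A_def linfrac_def)
    then have "fst (?\<Psi> q) = fst (ASp2_act (inv\<^bsub>ASp2\<^esub> A) (ASp2_act A q))"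
      by (simp add: ASp2_act_eq)
    also have "\<dots> = fst q"
      using ASp2_act_mult[OF inv_closed[OF A] A q] A by (simp add: ASp2_act_one)
    finally show ?thesis .
  qed
  have "hol_isometric ?\<Psi>"
    using A by (intro hol_isometric_compose hol_isometric_ASp2_act \<Phi>) simp
  then obtain B where B: "B \<in> carrier ASp2" "\<And>q. q \<in> HC \<Longrightarrow> ?\<Psi> q = ASp2_act B q"
    using hol_isometric_over_identity fst_\<Psi> by blast
  have "\<Phi> q = ASp2_act (A \<otimes>\<^bsub>ASp2\<^esub> B) q" if q: "q \<in> HC" for q
  proof -
    have "\<Phi> q = ASp2_act (A \<otimes>\<^bsub>ASp2\<^esub> inv\<^bsub>ASp2\<^esub> A) (\<Phi> q)"
      using A by (simp add: ASp2_act_one)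
    also have "\<dots> = ASp2_act A (?\<Psi> q)"
      using ASp2_act_mult[OF A inv_closed[OF A] \<Phi>_HC[OF q]] by (simp only: comp_apply)
    also have "\<dots> = ASp2_act (A \<otimes>\<^bsub>ASp2\<^esub> B) q"
      using ASp2_act_mult A B q by simp
    finally show ?thesis .
  qed
  with A B(1) show ?thesis
    by blast
qed

section \<open>The action transported to the tangent bundle\<close>

lemma ASp2_on_TN_eq:
  assumes "A \<in> carrier ASp2" "p \<in> TN"
  shows "ASp2_on_TN A p = HC_to_TN (ASp2_act A (TN_to_HC p))"
  using assms ASp2_act_HC by (simp add: ASp2_on_TN_def inv_into_TN_to_HC)

lemma ASp2_on_TN_maps:
  assumes "A \<in> carrier ASp2" "p \<in> TN"
  shows "ASp2_on_TN A p \<in> TN"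
  using assms ASp2_act_HC by (simp add: ASp2_on_TN_eq)

lemma ASp2_on_TN_mult:
  assumes "A \<in> carrier ASp2" "B \<in> carrier ASp2" "p \<in> TN"
  shows "ASp2_on_TN (A \<otimes>\<^bsub>ASp2\<^esub> B) p = ASp2_on_TN A (ASp2_on_TN B p)"
proof -
  interpret group ASp2
    by (rule group_ASp2)
  show ?thesis
    using assms ASp2_on_TN_maps[OF assms(2,3)] by (simp add: ASp2_on_TN_eq ASp2_act_mult)
qed

lemma ASp2_on_TN_inverse:
  assumes "A \<in> carrier ASp2" "p \<in> TN"
  shows "ASp2_on_TN (inv\<^bsub>ASp2\<^esub> A) (ASp2_on_TN A p) = p"
    and "ASp2_on_TN A (ASp2_on_TN (inv\<^bsub>ASp2\<^esub> A) p) = p"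
proof -
  interpret group ASp2
    by (rule group_ASp2)
  have "ASp2_on_TN \<one>\<^bsub>ASp2\<^esub> p = p"
    using assms(2) by (simp add: ASp2_on_TN_eq ASp2_act_one)
  then show "ASp2_on_TN (inv\<^bsub>ASp2\<^esub> A) (ASp2_on_TN A p) = p"
      "ASp2_on_TN A (ASp2_on_TN (inv\<^bsub>ASp2\<^esub> A) p) = p"
    using assms by (simp_all flip: ASp2_on_TN_mult)
qed

lemma ASp2_on_TN_in_Bij:
  assumes "A \<in> carrier ASp2"
  shows "ASp2_on_TN A \<in> Bij TN"
proof -
  interpret group ASp2
    by (rule group_ASp2)
  have "bij_betw (ASp2_on_TN A) TN TN"
    using assms
    by (intro bij_betw_byWitness[where f' = "ASp2_on_TN (inv\<^bsub>ASp2\<^esub> A)"] ballI image_subsetI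
        ASp2_on_TN_inverse ASp2_on_TN_maps inv_closed)
  then show ?thesis
    by (simp add: Bij_def ASp2_on_TN_def)
qed

text \<open>Stated for any \<open>g\<close> agreeing on \<open>TN\<close>, so that it also covers
  \<open>inv_into TN (ASp2_on_TN A)\<close>, which is identified only there.\<close>

lemma smooth_on_ASp2_on_TN:
  assumes "A \<in> carrier ASp2" "\<And>p. p \<in> TN \<Longrightarrow> g p = ASp2_on_TN A p"
  shows "smooth_on TN g"
proof -
  let ?c = "fst A$2$1" and ?d = "fst A$2$2"
  let ?i = "\<lambda>q. inverse (of_real ?c * fst q + of_real ?d) :: complex"
  let ?r = "\<lambda>q. (of_real (fst A$1$1) * fst q + of_real (fst A$1$2)) * ?i q"
  let ?s = "\<lambda>q. ((snd q + of_real (snd A$1) * fst q) + of_real (snd A$2)) * ?i q"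
  show ?thesis
  proof (rule smooth_on_rational)
    show "?r \<in> rational_maps ?c ?d" "?s \<in> rational_maps ?c ?d"
      by (intro rational_maps.intros)+
    show "?c \<noteq> 0 \<or> ?d \<noteq> 0"
      using assms(1) by (auto simp: ASp2_def det_2)
    show "g p = HC_to_TN (?r (TN_to_HC p), ?s (TN_to_HC p))" if "p \<in> TN" for p
      using assms that by (simp add: ASp2_on_TN_eq ASp2_act_eq linfrac_def divide_inverse)
  qed
qed

text \<open>The inverse map is the action of the group inverse, so smoothness of the action serves
  both directions.\<close>

lemma ASp2_on_TN_in_Diff:
  assumes "A \<in> carrier ASp2"
  shows "ASp2_on_TN A \<in> Diff TN"
proof -
  interpret group ASp2
    by (rule group_ASp2)
  note Bij = ASp2_on_TN_in_Bij[OF assms]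
  have "inv_into TN (ASp2_on_TN A) p = ASp2_on_TN (inv\<^bsub>ASp2\<^esub> A) p" if "p \<in> TN" for p
    using Bij that assms
    by (intro inv_into_f_eq ASp2_on_TN_inverse ASp2_on_TN_maps) (auto simp: Bij_def bij_betw_def)
  then show ?thesis
    using assms Bij smooth_on_ASp2_on_TN[OF assms] smooth_on_ASp2_on_TN[OF inv_closed[OF assms]]
    by (simp add: Diff_def)
qed

lemma hol_isometries_eq: "hol_isometries = ASp2_on_TN ` carrier ASp2"
proof (intro equalityI subsetI)
  fix \<phi> assume \<phi>: "\<phi> \<in> hol_isometries"
  then have Diff: "\<phi> \<in> Diff TN"
    by (simp add: hol_isometries_def)
  then have ext: "\<phi> \<in> extensional TN" and maps: "\<phi> \<in> TN \<rightarrow> TN"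
    by (simp_all add: Diff_def Bij_imp_extensional Bij_imp_funcset)
  obtain A where A: "A \<in> carrier ASp2"
      and eq: "\<And>q. q \<in> HC \<Longrightarrow> TN_to_HC (\<phi> (HC_to_TN q)) = ASp2_act A q"
    using hol_isometric_imp_ASp2_act \<phi> hol_isometries_iff[OF Diff] by fastforce
  have "\<phi> p = ASp2_on_TN A p" if "p \<in> TN" for p
  proof -
    have "TN_to_HC (\<phi> p) = ASp2_act A (TN_to_HC p)"
      using eq[of "TN_to_HC p"] that by simp
    then show ?thesis
      by (metis TN_to_HC_inverse ASp2_on_TN_eq A that)
  qed
  \<comment> \<open>Both maps are \<open>undefined\<close> off \<open>TN\<close>, so agreement on
    \<open>TN\<close> is equality.\<close>
  then have "\<phi> = ASp2_on_TN A"
    using ext by (intro extensionalityI[of \<phi> TN]) (simp_all add: ASp2_on_TN_def)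
  with A show "\<phi> \<in> ASp2_on_TN ` carrier ASp2"
    by blast
next
  fix \<phi> assume "\<phi> \<in> ASp2_on_TN ` carrier ASp2"
  then obtain A where A: "A \<in> carrier ASp2" and \<phi>: "\<phi> = ASp2_on_TN A"
    by blast
  have "hol_isometric (TN_to_HC \<circ> \<phi> \<circ> HC_to_TN)"
    by (rule hol_isometric_cong[OF hol_isometric_ASp2_act[OF A]]) (simp add: \<phi> ASp2_on_TN_eq A)
  then show "\<phi> \<in> hol_isometries"
    using hol_isometries_iff ASp2_on_TN_in_Diff[OF A] \<phi> by blast
qed

lemma ASp2_on_TN_hom: "ASp2_on_TN \<in> hom ASp2 (BijGroup TN)"
proof (rule homI)
  fix A B assume A: "A \<in> carrier ASp2" and B: "B \<in> carrier ASp2"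
  show "ASp2_on_TN (A \<otimes>\<^bsub>ASp2\<^esub> B) = ASp2_on_TN A \<otimes>\<^bsub>BijGroup TN\<^esub> ASp2_on_TN B"
  proof (rule extensionalityI[of _ TN])
    show "ASp2_on_TN (A \<otimes>\<^bsub>ASp2\<^esub> B) \<in> extensional TN"
      by (simp add: ASp2_on_TN_def)
  qed (use A B in \<open>simp_all add: BijGroup_def ASp2_on_TN_in_Bij compose_def ASp2_on_TN_mult\<close>)
qed (simp add: BijGroup_def ASp2_on_TN_in_Bij)

text \<open>After clearing denominators, \<tau> = \<i> with z = 0 and z = 1 determines all entries,
  since they are real and can be read off from real and imaginary parts.\<close>

lemma ASp2_act_effective:
  assumes A: "A \<in> carrier ASp2" and id: "\<And>q. q \<in> HC \<Longrightarrow> ASp2_act A q = q"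
  shows "A = \<one>\<^bsub>ASp2\<^esub>"
proof -
  obtain M X where MX: "A = (M, X)"
    by (cases A)
  have nz: "of_real (M$2$1) * \<tau> + of_real (M$2$2) \<noteq> (0::complex)" if "Im \<tau> > 0" for \<tau>
    using A by (intro automorphy_factor_nonzero[OF that]) (auto simp: MX ASp2_def det_2)
  have eq: "of_real (M$1$1) * \<tau> + of_real (M$1$2) = \<tau> * (of_real (M$2$1) * \<tau> + of_real (M$2$2))"
    "z + of_real (X$1) * \<tau> + of_real (X$2) = z * (of_real (M$2$1) * \<tau> + of_real (M$2$2))"
    if "Im \<tau> > 0" for \<tau> z
    using id[of "(\<tau>, z)"] nz[OF that] that by (auto simp: MX HC_def divide_eq_eq)
  have "X$1 = 0" "X$2 = 0"
    using eq(2)[of \<i> 0] by (auto simp: complex_eq_iff)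
  moreover from this have "M$2$1 = 0" "M$2$2 = 1"
    using eq(2)[of \<i> 1] by (auto simp: complex_eq_iff)
  moreover from this have "M$1$1 = 1" "M$1$2 = 0"
    using eq(1)[of \<i>] by (auto simp: complex_eq_iff)
  ultimately show ?thesis
    by (simp add: MX ASp2_def vec_eq_iff forall_2 mat_def)
qed

text \<open>The set equality comes from the classification; effectiveness supplies the trivial
  kernel that turns the homomorphism into an isomorphism onto the isometry group.\<close>

theorem theorem3p11:
  "group ASp2 \<and>
   subgroup hol_isometries (BijGroup TN) \<and>
   ASp2_on_TN \<in> iso ASp2 hol_isometry_group \<and>
   hol_isometries = ASp2_on_TN ` carrier ASp2"
proof -
  interpret group_hom ASp2 "BijGroup TN" ASp2_on_TN
    by (intro group_hom.intro group_hom_axioms.intro group_ASp2 group_BijGroup ASp2_on_TN_hom)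
  have "inj_on ASp2_on_TN (carrier ASp2)"
  proof (rule inj_on_one_iff[THEN iffD2], intro allI impI)
    fix A assume A: "A \<in> carrier ASp2" and "ASp2_on_TN A = \<one>\<^bsub>BijGroup TN\<^esub>"
    then have id: "ASp2_on_TN A p = p" if "p \<in> TN" for p
      using that by (simp add: BijGroup_def)
    show "A = \<one>\<^bsub>ASp2\<^esub>"
    proof (rule ASp2_act_effective[OF A])
      fix q assume "q \<in> HC"
      then show "ASp2_act A q = q"
        using id[of "HC_to_TN q"] A by (metis ASp2_on_TN_eq HC_to_TN_in_TN_iff HC_to_TN_inverse)
    qed
  qed
  then have "ASp2_on_TN \<in> iso ASp2 hol_isometry_group"
    using homh unfolding iso_def hol_isometry_group_def hom_def
    by (auto simp: hol_isometries_eq bij_betw_def)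
  moreover have "subgroup hol_isometries (BijGroup TN)"
    unfolding hol_isometries_eq by (rule img_is_subgroup)
  ultimately show ?thesis
    using group_ASp2 hol_isometries_eq by blast
qed

end
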